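(* The subcubic outerplanar graph $H$ defined in the context is not packing $(1,2,2,4)$-colorable.
   Context: A graph is subcubic if its maximum degree is at most $3$. For a non-decreasing sequence $S=(s_1,\dots,s_k)$ of positive integers, a packing $S$-coloring of a graph $G$ is a partition of $V(G)$ into sets $V_1,\dots,V_k$ (some possibly empty) such that, for each $1\le i\le k$, the distance in $G$ between any two distinct vertices $x,y\in V_i$ is at least $s_i+1$. $G$ is packing $S$-colorable if it has a packing $S$-coloring. Construction of $H$. Let $B$ be the graph on $9$ vertices consisting of three disjoint triangles $b_1b_2b_3$, $c_1c_2c_3$, $d_1d_2d_3$ together with the two edges $b_2c_1$ and $b_3d_1$; call $b_1$ its root. Gadget $G_3$ (on $21$ vertices) consists of a triangle $u_1u_2u_3$ and two disjoint copies of $B$, with $u_2$ joined by an edge to the root of one copy and $u_3$ joined by an edge to the root of the other copy; call $u_1$ the root of $G_3$. The graph $H$ consists of a triangle $v_1v_2v_3$ and three disjoint copies of $G_3$, one for each $i\in\{1,2,3\}$, with $v_i$ joined by an edge to the root of the $i$-th copy. *)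

theory Defs
  imports "HOL-Analysis.Analysis" "HOL-Library.Extended_Nat"
begin

text \<open>A graph is a pair of a vertex set and a set of two-element edges.\<close>

type_synonym 'a graph = "'a set \<times> 'a set set"

definition finite_simple_graph :: "'a graph \<Rightarrow> bool" where
  "finite_simple_graph G \<longleftrightarrow>
     finite (fst G) \<and> (\<forall>e\<in>snd G. e \<subseteq> fst G \<and> card e = 2)"

text \<open>Meaningful for graphs with finitely many edges, since \<open>card\<close> of an infinite set is 0.\<close>

definition vertex_degree :: "'a graph \<Rightarrow> 'a \<Rightarrow> nat" where
  "vertex_degree G v = card {e \<in> snd G. v \<in> e}"

definition subcubic :: "'a graph \<Rightarrow> bool" where
  "subcubic G \<longleftrightarrow> (\<forall>v\<in>fst G. vertex_degree G v \<le> 3)"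

definition walk :: "'a graph \<Rightarrow> 'a list \<Rightarrow> bool" where
  "walk G p \<longleftrightarrow> p \<noteq> [] \<and> set p \<subseteq> fst G \<and>
     (\<forall>i. Suc i < length p \<longrightarrow> {p ! i, p ! Suc i} \<in> snd G)"

text \<open>The distance is \<open>\<infinity>\<close> if the two vertices are not connected.\<close>

definition distance :: "'a graph \<Rightarrow> 'a \<Rightarrow> 'a \<Rightarrow> enat" where
  "distance G x y = (INF p \<in> {p. walk G p \<and> hd p = x \<and> last p = y}. enat (length p - 1))"

text \<open>The sequence \<open>S\<close> is a list, so its classes are indexed from 0. It is meant
  to be non-decreasing with positive entries; the definition makes sense without this.\<close>

definition packing_coloring :: "'a graph \<Rightarrow> nat list \<Rightarrow> (nat \<Rightarrow> 'a set) \<Rightarrow> bool" where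
  "packing_coloring G S W \<longleftrightarrow>
     (\<Union>i<length S. W i) = fst G \<and>
     disjoint_family_on W {..<length S} \<and>
     (\<forall>i<length S. \<forall>x\<in>W i. \<forall>y\<in>W i. x \<noteq> y \<longrightarrow> distance G x y \<ge> enat (S ! i + 1))"

definition packing_colorable :: "'a graph \<Rightarrow> nat list \<Rightarrow> bool" where
  "packing_colorable G S \<longleftrightarrow> (\<exists>W. packing_coloring G S W)"

text \<open>A drawing places the vertices injectively and represents each edge by an arc joining
  its endpoints. It is plane if arcs meet vertices and each other only in common endpoints.\<close>

definition plane_drawing ::
    "'a graph \<Rightarrow> ('a \<Rightarrow> complex) \<Rightarrow> ('a set \<Rightarrow> real \<Rightarrow> complex) \<Rightarrow> bool" where
  "plane_drawing G pos crv \<longleftrightarrow>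
     inj_on pos (fst G) \<and>
     (\<forall>e\<in>snd G. arc (crv e) \<and> {pathstart (crv e), pathfinish (crv e)} = pos ` e \<and>
        path_image (crv e) \<inter> pos ` fst G = pos ` e) \<and>
     (\<forall>e\<in>snd G. \<forall>f\<in>snd G. e \<noteq> f \<longrightarrow>
        path_image (crv e) \<inter> path_image (crv f) = pos ` (e \<inter> f))"

definition drawing_image ::
    "'a graph \<Rightarrow> ('a \<Rightarrow> complex) \<Rightarrow> ('a set \<Rightarrow> real \<Rightarrow> complex) \<Rightarrow> complex set" where
  "drawing_image G pos crv = pos ` fst G \<union> (\<Union>e\<in>snd G. path_image (crv e))"

text \<open>For a compact set in the plane, \<open>outside\<close> is the unbounded component of the complement,
  that is, the outer face of the drawing.\<close>

definition outerplanar :: "'a graph \<Rightarrow> bool" where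
  "outerplanar G \<longleftrightarrow>
     (\<exists>pos crv. plane_drawing G pos crv \<and>
        (\<forall>v\<in>fst G. pos v \<in> frontier (outside (drawing_image G pos crv))))"

datatype three = T1 | T2 | T3

definition triangle_edges :: "(three \<Rightarrow> 'a) \<Rightarrow> 'a set set" where
  "triangle_edges f = {{f T1, f T2}, {f T2, f T3}, {f T1, f T3}}"

datatype B_vertex = Bb three | Bc three | Bd three

text \<open>\<open>Copy2\<close> and \<open>Copy3\<close> are the copies of \<open>B\<close> attached to \<open>u\<^sub>2\<close> and \<open>u\<^sub>3\<close>.\<close>

datatype G3_vertex = U three | Copy2 B_vertex | Copy3 B_vertex

datatype H_vertex = V three | Copy three G3_vertex

definition B_edges :: "B_vertex set set" where
  "B_edges = triangle_edges Bb \<union> triangle_edges Bc \<union> triangle_edges Bd \<union> {{Bb T2, Bc T1}, {Bb T3, Bd T1}}"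

definition G3_edges :: "G3_vertex set set" where
  "G3_edges = triangle_edges U \<union> (`) Copy2 ` B_edges \<union> (`) Copy3 ` B_edges \<union>
     {{U T2, Copy2 (Bb T1)}, {U T3, Copy3 (Bb T1)}}"

definition H_edges :: "H_vertex set set" where
  "H_edges = triangle_edges V \<union> (\<Union>i. (`) (Copy i) ` G3_edges) \<union> (\<Union>i. {{V i, Copy i (U T1)}})"

definition H :: "H_vertex graph" where
  "H = (UNIV, H_edges)"

lemma UNIV_three: "UNIV = {T1, T2, T3}"
  by (auto intro: three.exhaust)

lemma UNIV_B_vertex: "UNIV = range Bb \<union> range Bc \<union> range Bd"
proof -
  have "x \<in> range Bb \<union> range Bc \<union> range Bd" for x
    by (cases x) auto
  then show ?thesis by blast
qed

lemma UNIV_G3_vertex: "UNIV = range U \<union> range Copy2 \<union> range Copy3"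
proof -
  have "x \<in> range U \<union> range Copy2 \<union> range Copy3" for x
    by (cases x) auto
  then show ?thesis by blast
qed

lemma UNIV_H_vertex: "UNIV = range V \<union> (\<Union>i. range (Copy i))"
proof -
  have "x \<in> range V \<union> (\<Union>i. range (Copy i))" for x
    by (cases x) auto
  then show ?thesis by blast
qed

lemma finite_H_vertices: "finite (UNIV :: H_vertex set)"
  unfolding UNIV_H_vertex UNIV_G3_vertex UNIV_B_vertex UNIV_three by simp

lemma card_triangle_edge: "e \<in> triangle_edges f \<Longrightarrow> inj f \<Longrightarrow> card e = 2"
  by (auto simp: triangle_edges_def inj_eq)

lemma card_B_edge: "e \<in> B_edges \<Longrightarrow> card e = 2"
  by (auto simp: B_edges_def inj_def dest!: card_triangle_edge)

lemma card_G3_edge: "e \<in> G3_edges \<Longrightarrow> card e = 2"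
  by (auto simp: G3_edges_def card_image inj_on_def card_B_edge dest!: card_triangle_edge)

lemma card_H_edge: "e \<in> H_edges \<Longrightarrow> card e = 2"
  by (auto simp: H_edges_def card_image inj_on_def card_G3_edge dest!: card_triangle_edge)

lemma finite_simple_graph_H: "finite_simple_graph H"
  by (simp add: finite_simple_graph_def H_def finite_H_vertices card_H_edge)

lemma card_H_vertices: "card (fst H) = 66"
  unfolding H_def UNIV_H_vertex UNIV_G3_vertex UNIV_B_vertex UNIV_three by simp

end

theory Submission
  imports Defs
begin

text \<open>Of two triangles joined by an edge, at least one uses color 4 (the class \<open>W 3\<close>). Vertices
  \<open>u\<^sub>2\<close> and \<open>u\<^sub>3\<close> of a gadget never have color 4: they are too close to the triangles \<open>b\<close> and \<open>c\<close>
  of the attached copy of \<open>B\<close>. If no \<open>v\<^sub>i\<close> has color 4, all three vertices \<open>u\<^sub>1\<close> do, at distance 3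
  from each other. If \<open>v\<^sub>i\<close> has color 4, then the \<open>u\<close>-triangle and the \<open>b\<close>-triangles next to it are
  within distance 4 of \<open>v\<^sub>i\<close>, so they avoid color 4 although they are joined.

  For outerplanarity, the vertices are placed on a parabola in an order in which no two edges
  interleave, and the edges are drawn as chords.\<close>

section \<open>Graphs with a non-crossing linear order are outerplanar\<close>

definition parabola :: "real \<Rightarrow> complex" where
  "parabola t = Complex t (t\<^sup>2)"

lemma Re_parabola [simp]: "Re (parabola t) = t"
  and Im_parabola [simp]: "Im (parabola t) = t\<^sup>2"
  by (simp_all add: parabola_def)

lemma parabola_eq_iff [simp]: "parabola s = parabola t \<longleftrightarrow> s = t"
  by (auto simp: parabola_def)

text \<open>With \<open>x = Re z\<close>, the chord lies on the line
  \<open>y = (a + b) * x - a * b\<close>, whose height above the parabola factors as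
  \<open>(x - a) * (b - x)\<close>.\<close>

lemma parabola_chord:
  assumes "z \<in> closed_segment (parabola a) (parabola b)" and "a \<le> b"
  shows "a \<le> Re z" "Re z \<le> b" "Im z = (Re z)\<^sup>2 + (Re z - a) * (b - Re z)"
proof -
  obtain u where u: "0 \<le> u" "u \<le> 1" "z = (1 - u) *\<^sub>R parabola a + u *\<^sub>R parabola b"
    using assms(1) by (auto simp: closed_segment_def)
  have re: "Re z = a + u * (b - a)"
    by (simp add: u(3) algebra_simps)
  show "a \<le> Re z"
    using u(1) assms(2) re by simp
  show "Re z \<le> b"
    using mult_right_mono[of u 1 "b - a"] u(2) assms(2) re by simp
  have "Im z = (1 - u) * a\<^sup>2 + u * b\<^sup>2"
    by (simp add: u(3))
  then show "Im z = (Re z)\<^sup>2 + (Re z - a) * (b - Re z)"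
    by (simp add: re power2_eq_square algebra_simps)
qed

lemma parabola_chord_above:
  assumes "z \<in> closed_segment (parabola a) (parabola b)" and "a \<le> b"
  shows "(Re z)\<^sup>2 \<le> Im z"
    and "Im z = (Re z)\<^sup>2 \<Longrightarrow> z = parabola a \<or> z = parabola b"
  using parabola_chord[OF assms] by (auto simp: complex_eq_iff)

text \<open>At a common point both chords have the same height above the parabola. The difference of
  the two heights is a sum of two nonnegative terms, so both vanish, which leaves only a shared
  endpoint.\<close>

lemma parabola_nested_chords:
  assumes z: "z \<in> closed_segment (parabola a) (parabola b)" "z \<in> closed_segment (parabola c) (parabola d)"
    and ord: "a \<le> c" "c \<le> d" "d \<le> b" and ne: "(a, b) \<noteq> (c, d)"
  shows "z \<in> parabola ` ({a, b} \<inter> {c, d})"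
proof -
  define x where "x = Re z"
  note ab = parabola_chord[OF z(1), folded x_def] and cd = parabola_chord[OF z(2), folded x_def]
  have x: "c \<le> x" "x \<le> d" and im: "(x - a) * (b - x) = (x - c) * (d - x)"
    using ab cd ord by auto
  have "(c - a) * (b - x) + (x - c) * (b - d) = 0"
    using im by (simp add: algebra_simps)
  moreover have "0 \<le> (c - a) * (b - x)" "0 \<le> (x - c) * (b - d)"
    using x ord by simp_all
  ultimately have "(c - a) * (b - x) = 0" "(x - c) * (b - d) = 0"
    by linarith+
  \<comment> \<open>Of the four combinations, \<open>a = c\<close> with \<open>b = d\<close>
    contradicts \<open>ne\<close>, and \<open>x = b\<close> with \<open>x = c\<close> forces
    \<open>d = b\<close>.\<close>
  then have "x = a \<and> a = c \<or> x = b \<and> b = d"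
    using x ord ne by auto
  moreover have "z = parabola x" if "x = c \<or> x = d"
    using that cd(3) ord by (auto simp: complex_eq_iff x_def)
  ultimately show ?thesis
    by auto
qed

text \<open>Intervals that do not interleave are nested or follow one another. In the latter case
  the chords can only meet where one interval ends and the other begins.\<close>

lemma parabola_noncrossing_chords:
  assumes z: "z \<in> closed_segment (parabola a) (parabola b)" "z \<in> closed_segment (parabola c) (parabola d)"
    and ord: "a \<le> b" "c \<le> d" and ne: "(a, b) \<noteq> (c, d)"
    and nc: "\<not> (a < c \<and> c < b \<and> b < d)" "\<not> (c < a \<and> a < d \<and> d < b)"
  shows "z \<in> parabola ` ({a, b} \<inter> {c, d})"
proof -
  consider "a \<le> c" "d \<le> b" | "c \<le> a" "b \<le> d" | "b \<le> c" | "d \<le> a"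
    using nc by linarith
  then show ?thesis
  proof cases
    case 1
    then show ?thesis
      using parabola_nested_chords[OF z] ord ne by auto
  next
    case 2
    then show ?thesis
      using parabola_nested_chords[OF z(2,1)] ord ne by (auto simp: Int_commute)
  next
    case 3
    then have "Re z = b" "b = c"
      using parabola_chord[OF z(1)] parabola_chord[OF z(2)] ord by auto
    then have "z = parabola b"
      using parabola_chord(3)[OF z(1)] ord by (simp add: complex_eq_iff)
    then show ?thesis
      using \<open>b = c\<close> by auto
  next
    case 4
    then have "Re z = a" "a = d"
      using parabola_chord[OF z(1)] parabola_chord[OF z(2)] ord by auto
    then have "z = parabola a"
      using parabola_chord(3)[OF z(1)] ord by (simp add: complex_eq_iff)
    then show ?thesis
      using \<open>a = d\<close> by auto
  qed
qed

text \<open>The open vertical ray \<open>R\<close> below the point avoids \<open>S\<close> and is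
  connected and unbounded, so it lies in the outer face; the point is a limit of \<open>R\<close>
  but belongs to \<open>S\<close>.\<close>

lemma parabola_in_frontier_outside:
  assumes S: "\<And>z. z \<in> S \<Longrightarrow> (Re z)\<^sup>2 \<le> Im z" and t: "parabola t \<in> S"
  shows "parabola t \<in> frontier (outside S)"
proof -
  define R where "R = {z. Re z = t \<and> Im z < t\<^sup>2}"
  have "R = {z. Re z \<le> t} \<inter> {z. t \<le> Re z} \<inter> {z. Im z < t\<^sup>2}"
    by (auto simp: R_def)
  then have "convex R"
    by (simp add: convex_Int convex_halfspace_Re_le convex_halfspace_Re_ge convex_halfspace_Im_lt)
  have disj: "R \<subseteq> - S"
    using S by (force simp: R_def)
  have unb: "\<not> bounded R"
  proof
    assume "bounded R"
    then obtain M where M: "\<And>z. z \<in> R \<Longrightarrow> norm z \<le> M"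
      by (auto simp: bounded_iff)
    \<comment> \<open>The imaginary part is negative, hence below \<open>t\<^sup>2\<close>, and its
      absolute value exceeds \<open>M\<close>.\<close>
    have "Complex t (- \<bar>M\<bar> - 1) \<in> R"
      using zero_le_power2[of t] by (auto simp: R_def intro: less_le_trans[of _ 0])
    then have "\<bar>- \<bar>M\<bar> - 1\<bar> \<le> M"
      using M abs_Im_le_cmod[of "Complex t (- \<bar>M\<bar> - 1)"] by fastforce
    then show False
      by linarith
  qed
  have "R \<subseteq> outside S"
  proof
    fix z assume "z \<in> R"
    then have "R \<subseteq> connected_component_set (- S) z"
      by (intro connected_component_maximal convex_connected \<open>convex R\<close> disj)
    then have "\<not> bounded (connected_component_set (- S) z)"
      using unb bounded_subset by blast
    then show "z \<in> outside S"
      using \<open>z \<in> R\<close> disj by (auto simp: outside_def)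
  qed
  moreover have "parabola t \<in> closure R"
  proof (rule closure_sequential[THEN iffD2], intro exI conjI allI)
    show "Complex t (t\<^sup>2 - inverse (real (Suc n))) \<in> R" for n
      by (simp add: R_def)
    have "(\<lambda>n. Complex t (t\<^sup>2 - inverse (real (Suc n)))) \<longlonglongrightarrow> Complex t (t\<^sup>2 - 0)"
      by (intro tendsto_Complex tendsto_intros LIMSEQ_inverse_real_of_nat)
    then show "(\<lambda>n. Complex t (t\<^sup>2 - inverse (real (Suc n)))) \<longlonglongrightarrow> parabola t"
      by (simp add: parabola_def)
  qed
  ultimately have "parabola t \<in> closure (outside S)"
    using closure_mono by blast
  moreover have "parabola t \<notin> interior (outside S)"
    using t interior_subset outside_no_overlap[of S] by blast
  ultimately show ?thesis
    by (simp add: frontier_def)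
qed

section \<open>From non-crossing orders to plane drawings\<close>

text \<open>Since \<open>{a, b}\<close> and \<open>{b, a}\<close> are the same edge and the two
  edges may be exchanged, this single pattern covers every way of interleaving.\<close>

definition noncrossing :: "('a \<Rightarrow> real) \<Rightarrow> 'a set set \<Rightarrow> bool" where
  "noncrossing l E \<longleftrightarrow>
     (\<forall>a b c d. {a, b} \<in> E \<longrightarrow> {c, d} \<in> E \<longrightarrow> \<not> (l a < l c \<and> l c < l b \<and> l b < l d))"

lemma noncrossingD:
  "noncrossing l E \<Longrightarrow> {a, b} \<in> E \<Longrightarrow> {c, d} \<in> E \<Longrightarrow> l a < l c \<Longrightarrow> l c < l b \<Longrightarrow> l b < l d \<Longrightarrow> False"
  unfolding noncrossing_def by blast

text \<open>Chords of the parabola \<open>y = x\<^sup>2\<close> cross only if their endpoints interleave, and all of them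
  lie above the parabola, so every vertex is seen from below.\<close>

theorem outerplanar_if_noncrossing:
  assumes G: "finite_simple_graph G" and inj: "inj_on l (fst G)" and nc: "noncrossing l (snd G)"
  shows "outerplanar G"
proof -
  define pos where "pos = parabola \<circ> l"
  \<comment> \<open>An edge is an unordered set; \<open>Min\<close> and \<open>Max\<close> of its
    labels direct its chord from left to right.\<close>
  define crv where "crv e = linepath (parabola (Min (l ` e))) (parabola (Max (l ` e)))" for e
  have edge: "\<exists>a b. e = {a, b} \<and> a \<in> fst G \<and> b \<in> fst G \<and> l a < l b \<and>
      crv e = linepath (parabola (l a)) (parabola (l b))" if "e \<in> snd G" for e
  proof -
    have "e \<subseteq> fst G" "card e = 2"
      using G that by (auto simp: finite_simple_graph_def)
    then obtain x y where xy: "e = {x, y}" "x \<noteq> y" "x \<in> fst G" "y \<in> fst G"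
      by (auto simp: card_2_iff)
    then consider "l x < l y" | "l y < l x"
      using inj by (metis inj_onD linorder_neqE_linordered_idom)
    then show ?thesis
    proof cases
      case 1
      then show ?thesis
        using xy by (intro exI[of _ x] exI[of _ y]) (simp add: crv_def)
    next
      case 2
      then show ?thesis
        using xy by (intro exI[of _ y] exI[of _ x]) (auto simp: crv_def)
    qed
  qed
  have pos_inj: "inj_on pos (fst G)"
    using inj by (auto simp: pos_def inj_on_def)
  have e1: "arc (crv e)" "{pathstart (crv e), pathfinish (crv e)} = pos ` e"
    "path_image (crv e) \<inter> pos ` fst G = pos ` e" if e: "e \<in> snd G" for e
  proof -
    obtain a b where ab: "e = {a, b}" "a \<in> fst G" "b \<in> fst G" "l a < l b"
      "crv e = linepath (parabola (l a)) (parabola (l b))"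
      using edge[OF e] by blast
    show "arc (crv e)"
      using ab by simp
    show "{pathstart (crv e), pathfinish (crv e)} = pos ` e"
      using ab by (simp add: pos_def)
    have "z \<in> pos ` e" if "z \<in> closed_segment (parabola (l a)) (parabola (l b))" "z \<in> pos ` fst G" for z
      using parabola_chord_above(2)[OF that(1)] that(2) ab by (auto simp: pos_def)
    then show "path_image (crv e) \<inter> pos ` fst G = pos ` e"
      using ab by (auto simp: pos_def)
  qed
  have e2: "path_image (crv e) \<inter> path_image (crv f) = pos ` (e \<inter> f)"
    if ef: "e \<in> snd G" "f \<in> snd G" "e \<noteq> f" for e f
  proof -
    obtain a b where ab: "e = {a, b}" "a \<in> fst G" "b \<in> fst G" "l a < l b"
      "crv e = linepath (parabola (l a)) (parabola (l b))"
      using edge[OF ef(1)] by blast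
    obtain c d where cd: "f = {c, d}" "c \<in> fst G" "d \<in> fst G" "l c < l d"
      "crv f = linepath (parabola (l c)) (parabola (l d))"
      using edge[OF ef(2)] by blast
    have l_eq: "l x = l y \<longleftrightarrow> x = y" if "x \<in> fst G" "y \<in> fst G" for x y
      using inj that by (auto dest: inj_onD)
    have ne: "(l a, l b) \<noteq> (l c, l d)"
      using ef(3) ab cd by (auto simp: l_eq)
    have "z \<in> pos ` (e \<inter> f)" if "z \<in> closed_segment (parabola (l a)) (parabola (l b))"
      "z \<in> closed_segment (parabola (l c)) (parabola (l d))" for z
    proof -
      have "z \<in> parabola ` ({l a, l b} \<inter> {l c, l d})"
        using ab cd ef noncrossingD[OF nc]
        by (intro parabola_noncrossing_chords that ne) auto
      \<comment> \<open>Injectivity of \<open>l\<close> turns common labels of the two edges into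
        common vertices.\<close>
      also have "{l a, l b} \<inter> {l c, l d} = l ` (e \<inter> f)"
        using inj_on_image_Int[OF inj, of e f] ab cd by simp
      finally show ?thesis
        by (simp add: pos_def image_comp)
    qed
    moreover have "pos ` e \<subseteq> path_image (crv e)" "pos ` f \<subseteq> path_image (crv f)"
      using ab cd by (auto simp: pos_def)
    ultimately show ?thesis
      using ab(5) cd(5) by auto
  qed
  have "plane_drawing G pos crv"
    unfolding plane_drawing_def using pos_inj e1 e2 by blast
  moreover have "pos v \<in> frontier (outside (drawing_image G pos crv))" if "v \<in> fst G" for v
    unfolding pos_def comp_def
  proof (rule parabola_in_frontier_outside)
    show "parabola (l v) \<in> drawing_image G (\<lambda>x. parabola (l x)) crv"
      using that by (auto simp: drawing_image_def)
  next
    fix z assume "z \<in> drawing_image G (\<lambda>x. parabola (l x)) crv"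
    then consider v where "z = parabola (l v)" | e where "e \<in> snd G" "z \<in> path_image (crv e)"
      by (auto simp: drawing_image_def)
    then show "(Re z)\<^sup>2 \<le> Im z"
    proof cases
      case 1
      then show ?thesis by simp
    next
      case 2
      then show ?thesis
        using edge[OF 2(1)] parabola_chord_above(1)[of z] by fastforce
    qed
  qed
  ultimately show ?thesis
    unfolding outerplanar_def by blast
qed

section \<open>The graph \<open>H\<close>\<close>

lemma doubleton_in_image_iff:
  assumes "inj f"
  shows "{x, y} \<in> (`) f ` E \<longleftrightarrow> (\<exists>a b. x = f a \<and> y = f b \<and> {a, b} \<in> E)"
proof
  assume "{x, y} \<in> (`) f ` E"
  then obtain e where e: "e \<in> E" "{x, y} = f ` e"
    by auto
  then obtain a b where ab: "x = f a" "y = f b"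
    by blast
  then have "f ` e = f ` {a, b}"
    using e(2) by simp
  then have "e = {a, b}"
    using assms by (simp only: inj_image_eq_iff)
  with e ab show "\<exists>a b. x = f a \<and> y = f b \<and> {a, b} \<in> E"
    by blast
next
  assume "\<exists>a b. x = f a \<and> y = f b \<and> {a, b} \<in> E"
  then obtain a b where "{x, y} = f ` {a, b}" "{a, b} \<in> E"
    by auto
  then show "{x, y} \<in> (`) f ` E"
    by blast
qed

lemma inj_constructors [simp]:
  "inj Bb" "inj Bc" "inj Bd" "inj U" "inj Copy2" "inj Copy3" "inj V" "inj (Copy i)"
  by (simp_all add: inj_def)

lemma G3_edge_iff:
  "{x, y} \<in> G3_edges \<longleftrightarrow> {x, y} \<in> triangle_edges U \<or>
     (\<exists>a b. x = Copy2 a \<and> y = Copy2 b \<and> {a, b} \<in> B_edges) \<or>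
     (\<exists>a b. x = Copy3 a \<and> y = Copy3 b \<and> {a, b} \<in> B_edges) \<or>
     {x, y} = {U T2, Copy2 (Bb T1)} \<or> {x, y} = {U T3, Copy3 (Bb T1)}"
  by (simp only: G3_edges_def Un_iff insert_iff empty_iff simp_thms disj_assoc
      doubleton_in_image_iff inj_constructors)

lemma H_edge_iff:
  "{x, y} \<in> H_edges \<longleftrightarrow> {x, y} \<in> triangle_edges V \<or>
     (\<exists>i a b. x = Copy i a \<and> y = Copy i b \<and> {a, b} \<in> G3_edges) \<or>
     (\<exists>i. {x, y} = {V i, Copy i (U T1)})"
  by (simp only: H_edges_def Un_iff UN_iff singleton_iff simp_thms disj_assoc bex_UNIV
      doubleton_in_image_iff inj_constructors)

lemma triangle_edge_iff:
  assumes "inj f"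
  shows "{x, y} \<in> triangle_edges f \<longleftrightarrow> (\<exists>i j. x = f i \<and> y = f j \<and> i \<noteq> j)"
proof
  assume "\<exists>i j. x = f i \<and> y = f j \<and> i \<noteq> j"
  then obtain i j where "x = f i" "y = f j" "i \<noteq> j"
    by blast
  then show "{x, y} \<in> triangle_edges f"
    by (cases i; cases j) (auto simp: triangle_edges_def)
next
  assume "{x, y} \<in> triangle_edges f"
  then show "\<exists>i j. x = f i \<and> y = f j \<and> i \<noteq> j"
    using three.distinct unfolding triangle_edges_def by (fastforce simp: doubleton_eq_iff)
qed

text \<open>The labels number the vertices in the order of a depth-first search.\<close>

fun B_label :: "B_vertex \<Rightarrow> real" where
  "B_label (Bb T1) = 0" | "B_label (Bb T2) = 1" | "B_label (Bb T3) = 5"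
| "B_label (Bc T1) = 2" | "B_label (Bc T2) = 3" | "B_label (Bc T3) = 4"
| "B_label (Bd T1) = 6" | "B_label (Bd T2) = 7" | "B_label (Bd T3) = 8"

fun G3_label :: "G3_vertex \<Rightarrow> real" where
  "G3_label (U T1) = 0" | "G3_label (U T2) = 1" | "G3_label (U T3) = 11"
| "G3_label (Copy2 x) = 2 + B_label x"
| "G3_label (Copy3 x) = 12 + B_label x"

text \<open>Each \<open>V i\<close> is followed by the 21 vertices of its gadget, so the blocks
  start 22 apart.\<close>

fun three_label :: "three \<Rightarrow> real" where
  "three_label T1 = 0" | "three_label T2 = 22" | "three_label T3 = 44"

fun H_label :: "H_vertex \<Rightarrow> real" where
  "H_label (V i) = three_label i"
| "H_label (Copy i x) = three_label i + 1 + G3_label x"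

lemma B_label_bounds: "0 \<le> B_label x" "B_label x \<le> 8"
  by (induction x rule: B_label.induct; simp)+

lemma G3_label_bounds: "0 \<le> G3_label x" "G3_label x \<le> 20"
proof -
  have "G3_label x \<in> {0..20}"
    by (cases x rule: G3_label.cases) (use B_label_bounds in \<open>auto intro: order_trans[of _ 8]\<close>)
  then show "0 \<le> G3_label x" "G3_label x \<le> 20"
    by auto
qed

lemma inj_B_label: "inj B_label"
proof (rule injI)
  show "x = y" if "B_label x = B_label y" for x y
    using that by (cases x rule: B_label.cases; cases y rule: B_label.cases) simp_all
qed

lemma inj_G3_label: "inj G3_label"
proof (rule injI)
  show "x = y" if "G3_label x = G3_label y" for x y
    using that
    by (cases x rule: G3_label.cases; cases y rule: G3_label.cases)
      (use B_label_bounds inj_B_label in \<open>auto simp: inj_eq; smt (verit)\<close>)+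
qed

lemma three_label_cases: "three_label i = 0 \<and> i = T1 \<or> three_label i = 22 \<and> i = T2 \<or> three_label i = 44 \<and> i = T3"
  by (cases i) auto

text \<open>The labels of gadget \<open>i\<close> lie strictly between \<open>three_label i\<close>
  and \<open>three_label i + 22\<close>, so a label determines its block, and then the vertex inside
  it.\<close>

lemma inj_H_label: "inj H_label"
proof (rule injI)
  show "x = y" if "H_label x = H_label y" for x y
  proof (cases x; cases y)
    fix i j a b
    assume xy: "x = Copy i a" "y = Copy j b"
    have "i = j"
      using that xy three_label_cases[of i] three_label_cases[of j] G3_label_bounds[of a] G3_label_bounds[of b]
      by auto
    with that xy show ?thesis
      using inj_G3_label by (auto simp: inj_eq)
  next
    fix i j
    assume "x = V i" "y = V j"
    then show ?thesis
      using that three_label_cases[of i] three_label_cases[of j] by auto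
  next
    fix i j a
    assume "x = V i" "y = Copy j a"
    then show ?thesis
      using that three_label_cases[of i] three_label_cases[of j] G3_label_bounds[of a] by auto
  next
    fix i j a
    assume "x = Copy j a" "y = V i"
    then show ?thesis
      using that three_label_cases[of i] three_label_cases[of j] G3_label_bounds[of a] by auto
  qed
qed

lemma noncrossing_B: "noncrossing B_label B_edges"
  unfolding noncrossing_def B_edges_def triangle_edges_def
  by (simp add: doubleton_eq_iff)

text \<open>Edges are sorted into those of the \<open>U\<close>-triangle, those of a copy of
  \<open>B\<close> shifted by \<open>s\<close>, and the joining edges, so that interleaving becomes
  a question of arithmetic.\<close>

lemma G3_edge_labels:
  assumes "{x, y} \<in> G3_edges"
  shows "G3_label x \<in> {0, 1, 11} \<and> G3_label y \<in> {0, 1, 11} \<or>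
     (\<exists>s a b. s \<in> {2, 12} \<and> {a, b} \<in> B_edges \<and> B_label a \<in> {0..8} \<and> B_label b \<in> {0..8} \<and>
       G3_label x = s + B_label a \<and> G3_label y = s + B_label b) \<or>
     (G3_label x, G3_label y) \<in> {(1, 2), (2, 1), (11, 12), (12, 11)}"
proof -
  consider "{x, y} \<in> triangle_edges U"
    | a b where "x = Copy2 a" "y = Copy2 b" "{a, b} \<in> B_edges"
    | a b where "x = Copy3 a" "y = Copy3 b" "{a, b} \<in> B_edges"
    | "{x, y} = {U T2, Copy2 (Bb T1)}" | "{x, y} = {U T3, Copy3 (Bb T1)}"
    using assms unfolding G3_edge_iff by blast
  then show ?thesis
  proof cases
    case 1
    then show ?thesis by (intro disjI1) (auto simp: triangle_edges_def doubleton_eq_iff)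
  next
    case (2 a b)
    show ?thesis
      by (rule disjI2, rule disjI1, intro exI[of _ 2] exI[of _ a] exI[of _ b])
        (simp add: 2 B_label_bounds)
  next
    case (3 a b)
    show ?thesis
      by (rule disjI2, rule disjI1, intro exI[of _ 12] exI[of _ a] exI[of _ b])
        (simp add: 3 B_label_bounds)
  qed (intro disjI2, auto simp: doubleton_eq_iff)
qed

text \<open>The two copies of \<open>B\<close> occupy the disjoint ranges from 2 to 10 and from 12
  to 20, which contain no label of a \<open>U\<close> vertex, and no label lies strictly between the
  ends of a joining edge. Only two edges of one copy remain, and there the shift cancels.\<close>

lemma noncrossing_G3: "noncrossing G3_label G3_edges"
  unfolding noncrossing_def
proof (intro allI impI notI)
  fix a b c d
  assume "{a, b} \<in> G3_edges" "{c, d} \<in> G3_edges"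
    and lt: "G3_label a < G3_label c \<and> G3_label c < G3_label b \<and> G3_label b < G3_label d"
  note ab = G3_edge_labels[OF this(1)] and cd = G3_edge_labels[OF this(2)]
  from ab show False
  proof (elim disjE exE conjE)
    fix s a' b'
    assume ab': "s \<in> {2, 12}" "{a', b'} \<in> B_edges" "B_label a' \<in> {0..8}" "B_label b' \<in> {0..8}"
      "G3_label a = s + B_label a'" "G3_label b = s + B_label b'"
    from cd show False
    proof (elim disjE exE conjE)
      fix t c' d'
      assume cd': "t \<in> {2, 12}" "{c', d'} \<in> B_edges" "B_label c' \<in> {0..8}" "B_label d' \<in> {0..8}"
        "G3_label c = t + B_label c'" "G3_label d = t + B_label d'"
      have "s = t"
        using ab' cd' lt by auto
      then show False
        using noncrossingD[OF noncrossing_B ab'(2) cd'(2)] ab'(5,6) cd'(5,6) lt by simp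
    qed (use ab' lt in auto)
  next
    assume "G3_label a \<in> {0, 1, 11}" "G3_label b \<in> {0, 1, 11}"
    with cd lt show False
      by (elim disjE exE conjE) auto
  next
    assume "(G3_label a, G3_label b) \<in> {(1, 2), (2, 1), (11, 12), (12, 11)}"
    with cd lt show False
      by (elim disjE exE conjE) auto
  qed
qed

lemma H_edge_labels:
  assumes "{x, y} \<in> H_edges"
  shows "H_label x \<in> {0, 22, 44} \<and> H_label y \<in> {0, 22, 44} \<or>
     (\<exists>s a b. s \<in> {0, 22, 44} \<and> {a, b} \<in> G3_edges \<and> G3_label a \<in> {0..20} \<and> G3_label b \<in> {0..20} \<and>
       H_label x = s + (1 + G3_label a) \<and> H_label y = s + (1 + G3_label b)) \<or>
     (H_label x, H_label y) \<in> {(0, 1), (1, 0), (22, 23), (23, 22), (44, 45), (45, 44)}"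
proof -
  consider "{x, y} \<in> triangle_edges V"
    | i a b where "x = Copy i a" "y = Copy i b" "{a, b} \<in> G3_edges"
    | i where "{x, y} = {V i, Copy i (U T1)}"
    using assms unfolding H_edge_iff by blast
  then show ?thesis
  proof cases
    case 1
    then show ?thesis by (intro disjI1) (auto simp: triangle_edges_def doubleton_eq_iff)
  next
    case (2 i a b)
    show ?thesis
      by (rule disjI2, rule disjI1, intro exI[of _ "three_label i"] exI[of _ a] exI[of _ b])
        (use three_label_cases[of i] in \<open>simp add: 2 G3_label_bounds, blast\<close>)
  next
    case (3 i)
    then show ?thesis
      by (intro disjI2, cases i) (auto simp: doubleton_eq_iff)
  qed
qed

text \<open>The argument for \<open>G3_edges\<close> one level up: gadgets occupy disjoint ranges
  that avoid the labels of the \<open>V i\<close>.\<close>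

lemma noncrossing_H: "noncrossing H_label H_edges"
  unfolding noncrossing_def
proof (intro allI impI notI)
  fix a b c d
  assume "{a, b} \<in> H_edges" "{c, d} \<in> H_edges"
    and lt: "H_label a < H_label c \<and> H_label c < H_label b \<and> H_label b < H_label d"
  note ab = H_edge_labels[OF this(1)] and cd = H_edge_labels[OF this(2)]
  from ab show False
  proof (elim disjE exE conjE)
    fix s a' b'
    assume ab': "s \<in> {0, 22, 44}" "{a', b'} \<in> G3_edges" "G3_label a' \<in> {0..20}" "G3_label b' \<in> {0..20}"
      "H_label a = s + (1 + G3_label a')" "H_label b = s + (1 + G3_label b')"
    from cd show False
    proof (elim disjE exE conjE)
      fix t c' d'
      assume cd': "t \<in> {0, 22, 44}" "{c', d'} \<in> G3_edges" "G3_label c' \<in> {0..20}" "G3_label d' \<in> {0..20}"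
        "H_label c = t + (1 + G3_label c')" "H_label d = t + (1 + G3_label d')"
      have "s = t"
        using ab' cd' lt by auto
      then show False
        using noncrossingD[OF noncrossing_G3 ab'(2) cd'(2)] ab'(5,6) cd'(5,6) lt by simp
    qed (use ab' lt in auto)
  next
    assume "H_label a \<in> {0, 22, 44}" "H_label b \<in> {0, 22, 44}"
    with cd lt show False
      by (elim disjE exE conjE) auto
  next
    assume "(H_label a, H_label b) \<in> {(0, 1), (1, 0), (22, 23), (23, 22), (44, 45), (45, 44)}"
    with cd lt show False
      by (elim disjE exE conjE) auto
  qed
qed

lemma outerplanar_H: "outerplanar H"
  by (rule outerplanar_if_noncrossing[OF finite_simple_graph_H, of H_label])
    (simp_all add: H_def inj_H_label noncrossing_H)

section \<open>The maximum degree of \<open>H\<close>\<close>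

text \<open>An edge at \<open>v\<close> is determined by its other end, so any list containing all
  neighbours bounds the degree.\<close>

lemma vertex_degree_le_neighbours:
  assumes G: "finite_simple_graph G" and N: "\<And>w. {v, w} \<in> snd G \<Longrightarrow> w \<in> set ws"
  shows "vertex_degree G v \<le> length ws"
proof -
  have "e \<in> (\<lambda>w. {v, w}) ` set ws" if e: "e \<in> snd G" "v \<in> e" for e
  proof -
    have "card e = 2"
      using G e by (auto simp: finite_simple_graph_def)
    then obtain x y where "e = {x, y}"
      unfolding card_2_iff by blast
    then obtain w where "e = {v, w}"
      using e(2) by blast
    then show ?thesis
      using N e by blast
  qed
  then have "vertex_degree G v \<le> card ((\<lambda>w. {v, w}) ` set ws)"
    unfolding vertex_degree_def by (intro card_mono) auto
  also have "\<dots> \<le> card (set ws)"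
    by (rule card_image_le) simp
  also have "\<dots> \<le> length ws"
    by (rule card_length)
  finally show ?thesis .
qed

fun others :: "three \<Rightarrow> three list" where
  "others T1 = [T2, T3]" | "others T2 = [T1, T3]" | "others T3 = [T1, T2]"

fun B_neighbours :: "B_vertex \<Rightarrow> B_vertex list" where
  "B_neighbours (Bb i) = map Bb (others i) @ (case i of T1 \<Rightarrow> [] | T2 \<Rightarrow> [Bc T1] | T3 \<Rightarrow> [Bd T1])"
| "B_neighbours (Bc i) = map Bc (others i) @ (if i = T1 then [Bb T2] else [])"
| "B_neighbours (Bd i) = map Bd (others i) @ (if i = T1 then [Bb T3] else [])"

fun G3_neighbours :: "G3_vertex \<Rightarrow> G3_vertex list" where
  "G3_neighbours (U i) =
     map U (others i) @ (case i of T1 \<Rightarrow> [] | T2 \<Rightarrow> [Copy2 (Bb T1)] | T3 \<Rightarrow> [Copy3 (Bb T1)])"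
| "G3_neighbours (Copy2 x) = map Copy2 (B_neighbours x) @ (if x = Bb T1 then [U T2] else [])"
| "G3_neighbours (Copy3 x) = map Copy3 (B_neighbours x) @ (if x = Bb T1 then [U T3] else [])"

fun H_neighbours :: "H_vertex \<Rightarrow> H_vertex list" where
  "H_neighbours (V i) = map V (others i) @ [Copy i (U T1)]"
| "H_neighbours (Copy i x) = map (Copy i) (G3_neighbours x) @ (if x = U T1 then [V i] else [])"

lemma B_neighbours: "{x, y} \<in> B_edges \<Longrightarrow> y \<in> set (B_neighbours x)"
  unfolding B_edges_def triangle_edges_def Un_iff insert_iff empty_iff doubleton_eq_iff
  by (elim disjE conjE; simp)

lemma G3_neighbours: "{x, y} \<in> G3_edges \<Longrightarrow> y \<in> set (G3_neighbours x)"
  unfolding G3_edge_iff triangle_edges_def insert_iff empty_iff doubleton_eq_iff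
  by (elim disjE exE conjE; simp add: B_neighbours)

lemma H_neighbours: "{x, y} \<in> H_edges \<Longrightarrow> y \<in> set (H_neighbours x)"
  unfolding H_edge_iff triangle_edges_def insert_iff empty_iff doubleton_eq_iff
  by (elim disjE exE conjE; simp add: G3_neighbours)

lemma length_others: "length (others i) = 2"
  by (cases i) auto

text \<open>The extra 1 at the root reserves room for the edge by which the copy is
  attached.\<close>

lemma length_B_neighbours: "length (B_neighbours x) + (if x = Bb T1 then 1 else 0) \<le> 3"
  by (cases x) (auto simp: length_others split: three.split)

lemma length_G3_neighbours: "length (G3_neighbours x) + (if x = U T1 then 1 else 0) \<le> 3"
proof (cases x)
  case (Copy2 y)
  then show ?thesis using length_B_neighbours[of y] by auto
next
  case (Copy3 y)
  then show ?thesis using length_B_neighbours[of y] by auto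
qed (auto simp: length_others split: three.split)

lemma length_H_neighbours: "length (H_neighbours x) \<le> 3"
proof (cases x)
  case (Copy i y)
  then show ?thesis using length_G3_neighbours[of y] by auto
qed (auto simp: length_others)

lemma subcubic_H: "subcubic H"
  unfolding subcubic_def
proof
  fix v
  have "vertex_degree H v \<le> length (H_neighbours v)"
    by (rule vertex_degree_le_neighbours[OF finite_simple_graph_H]) (simp add: H_def H_neighbours)
  also have "\<dots> \<le> 3"
    by (rule length_H_neighbours)
  finally show "vertex_degree H v \<le> 3" .
qed

section \<open>Packing colorings of \<open>H\<close>\<close>

lemma distance_le_walk: "walk G p \<Longrightarrow> distance G (hd p) (last p) \<le> enat (length p - 1)"
  unfolding distance_def by (rule INF_lower) simp

lemma walk_Cons_Cons:
  "walk G (x # y # p) \<longleftrightarrow> x \<in> fst G \<and> {x, y} \<in> snd G \<and> walk G (y # p)"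
  by (auto simp: walk_def nth_Cons split: nat.splits)

lemma walk_single: "walk G [x] \<longleftrightarrow> x \<in> fst G"
  by (simp add: walk_def)

text \<open>Classes are indexed from 0: \<open>W 0\<close> is independent, distinct vertices of
  \<open>W 1\<close> or of \<open>W 2\<close> are at least 3 apart, and those of \<open>W 3\<close>
  at least 5 apart.\<close>

locale packing_1224 =
  fixes G :: "'a graph" and W :: "nat \<Rightarrow> 'a set"
  assumes coloring: "packing_coloring G [1, 2, 2, 4] W"
    and edge_subset: "\<And>e. e \<in> snd G \<Longrightarrow> e \<subseteq> fst G"
begin

abbreviation adj :: "'a \<Rightarrow> 'a \<Rightarrow> bool" where
  "adj x y \<equiv> {x, y} \<in> snd G"

text \<open>A walk bounds the distance of its ends from above, the coloring bounds it from below.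
  The lemmas below apply this to walks of one to four edges.\<close>

lemma far:
  assumes "walk G p" "hd p \<noteq> last p" "hd p \<in> W i" "last p \<in> W i" "i < 4"
  shows "[1, 2, 2, 4] ! i < length p - 1"
proof -
  have "enat ([1, 2, 2, 4] ! i + 1) \<le> distance G (hd p) (last p)"
    using coloring assms(2-5) unfolding packing_coloring_def by simp
  also have "\<dots> \<le> enat (length p - 1)"
    by (rule distance_le_walk[OF assms(1)])
  finally show ?thesis
    by simp
qed

lemma adj_distinct_color: "adj x y \<Longrightarrow> x \<noteq> y \<Longrightarrow> x \<in> W i \<Longrightarrow> i < 4 \<Longrightarrow> y \<notin> W i"
proof
  assume xy: "adj x y" "x \<noteq> y" "x \<in> W i" "y \<in> W i" and i: "i < 4"
  have "[1, 2, 2, 4] ! i < length [x, y] - 1"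
    using xy i edge_subset[of "{x, y}"] by (intro far) (auto simp: walk_Cons_Cons walk_single)
  moreover have "i = 0 \<or> i = 1 \<or> i = 2 \<or> i = 3"
    using i by linarith
  ultimately show False
    by auto
qed

lemma path2_distinct_color:
  "adj x y \<Longrightarrow> adj y z \<Longrightarrow> x \<noteq> z \<Longrightarrow> x \<in> W i \<Longrightarrow> i \<in> {1, 2, 3} \<Longrightarrow> z \<notin> W i"
  using far[of "[x, y, z]" i] edge_subset[of "{x, y}"] edge_subset[of "{y, z}"]
  by (auto simp: walk_Cons_Cons walk_single)

lemma path3_not_both_W3:
  "adj x y \<Longrightarrow> adj y z \<Longrightarrow> adj z u \<Longrightarrow> x \<noteq> u \<Longrightarrow> x \<in> W 3 \<Longrightarrow> u \<notin> W 3"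
  using far[of "[x, y, z, u]" 3] edge_subset[of "{x, y}"] edge_subset[of "{y, z}"] edge_subset[of "{z, u}"]
  by (auto simp: walk_Cons_Cons walk_single)

lemma path4_not_both_W3:
  "adj x y \<Longrightarrow> adj y z \<Longrightarrow> adj z u \<Longrightarrow> adj u v \<Longrightarrow> x \<noteq> v \<Longrightarrow> x \<in> W 3 \<Longrightarrow> v \<notin> W 3"
  using far[of "[x, y, z, u, v]" 3] edge_subset[of "{x, y}"] edge_subset[of "{y, z}"]
    edge_subset[of "{z, u}"] edge_subset[of "{u, v}"]
  by (auto simp: walk_Cons_Cons walk_single)

lemma color_cases: "x \<in> fst G \<Longrightarrow> x \<in> W 0 \<or> x \<in> W 1 \<or> x \<in> W 2 \<or> x \<in> W 3"
proof -
  assume "x \<in> fst G"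
  then have "x \<in> (\<Union>i<length [1, 2, 2, 4 :: nat]. W i)"
    using coloring unfolding packing_coloring_def by blast
  then obtain i where i: "i < length [1, 2, 2, 4 :: nat]" "x \<in> W i"
    by blast
  moreover have "i = 0 \<or> i = 1 \<or> i = 2 \<or> i = 3"
    using i(1) unfolding list.size by linarith
  ultimately show ?thesis
    using i(2) by blast
qed

definition triangle :: "(three \<Rightarrow> 'a) \<Rightarrow> bool" where
  "triangle f \<longleftrightarrow> inj f \<and> (\<forall>i j. i \<noteq> j \<longrightarrow> adj (f i) (f j))"

lemma triangleD: "triangle f \<Longrightarrow> i \<noteq> j \<Longrightarrow> adj (f i) (f j) \<and> f i \<noteq> f j"
  by (auto simp: triangle_def inj_eq)

lemma triangle_vertex: "triangle f \<Longrightarrow> f i \<in> fst G"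
  using triangleD[of f i] edge_subset three.distinct(1) by (metis insert_subset)

text \<open>Pigeonhole: three pairwise adjacent vertices get distinct colors out of the three
  classes other than \<open>W 3\<close>, so each of these occurs.\<close>

lemma triangle_color:
  assumes f: "triangle f" and no3: "\<forall>i. f i \<notin> W 3" and k: "k < 3"
  shows "\<exists>i. f i \<in> W k"
proof (rule ccontr)
  assume none: "\<nexists>i. f i \<in> W k"
  then have *: "f i \<in> W 0 \<or> f i \<in> W 1 \<or> f i \<in> W 2" for i
    using color_cases[OF triangle_vertex[OF f], of i] no3 by blast
  have neq: "f j \<notin> W c" if "f i \<in> W c" "i \<noteq> j" "c < 4" for i j c
    using adj_distinct_color triangleD[OF f] that by metis
  have "k = 0 \<or> k = 1 \<or> k = 2"
    using k by linarith
  then show False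
    using none *[of T1] *[of T2] *[of T3] neq[of T1 _ T2] neq[of T1 _ T3] neq[of T2 _ T3] by auto
qed

text \<open>If neither triangle meets \<open>W 3\<close>, each meets both \<open>W 1\<close> and \<open>W 2\<close>, so by distance 2
  both ends of the joining edge must lie in \<open>W 0\<close>.\<close>

lemma joined_triangles:
  assumes f: "triangle f" and g: "triangle g" and adj: "adj (f i) (g j)" and disj: "range f \<inter> range g = {}"
  shows "\<exists>k. f k \<in> W 3 \<or> g k \<in> W 3"
proof (rule ccontr)
  assume no3: "\<nexists>k. f k \<in> W 3 \<or> g k \<in> W 3"
  \<comment> \<open>Stated for arbitrary triangles, so that it applies to both ends of the joining
    edge by symmetry.\<close>
  have *: "f i \<in> W 0" if f: "triangle f" and g: "triangle g" and adj: "adj (f i) (g j)"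
    and disj: "range f \<inter> range g = {}" and no3: "\<nexists>k. f k \<in> W 3 \<or> g k \<in> W 3" for f g i j
  proof -
    have "f i \<notin> W c" if "c \<in> {1, 2}" for c
    proof
      assume c: "f i \<in> W c"
      have "c < 3"
        using \<open>c \<in> {1, 2}\<close> by auto
      then obtain k where k: "g k \<in> W c"
        using triangle_color[OF g] no3 by blast
      have ne: "f i \<noteq> g k"
        using disj by auto
      show False
      proof (cases "k = j")
        case True
        then show False
          using adj_distinct_color[OF adj _ c] ne k \<open>c \<in> {1, 2}\<close> by auto
      next
        case False
        then show False
          using path2_distinct_color[OF adj _ ne c] triangleD[OF g, of j k] k \<open>c \<in> {1, 2}\<close> by auto
      qed
    qed
    then show ?thesis
      using color_cases[OF triangle_vertex[OF f], of i] no3 by auto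
  qed
  have "f i \<in> W 0" "g j \<in> W 0"
    using *[OF f g adj disj] *[OF g f, of j i] adj disj no3 by (auto simp: insert_commute)
  then show False
    using adj_distinct_color[OF adj, of 0] disj by auto
qed

text \<open>The walk \<open>r\<close>, \<open>b T1\<close>, \<open>b T2\<close>,
  \<open>c T1\<close>, \<open>c k\<close> has four edges, so every vertex of both triangles is
  within distance 4 of \<open>r\<close>. If \<open>r\<close> were in \<open>W 3\<close>, neither
  triangle would meet \<open>W 3\<close>, contrary to \<open>joined_triangles\<close>.\<close>

lemma root_neighbour_not_W3:
  assumes b: "triangle b" and c: "triangle c" and bc: "adj (b T2) (c T1)" and r: "adj r (b T1)"
    and disj: "range b \<inter> range c = {}" "r \<notin> range b" "r \<notin> range c"
  shows "r \<notin> W 3"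
proof
  assume W3: "r \<in> W 3"
  have b12: "adj (b T1) (b T2)"
    using triangleD[OF b] by simp
  have "b k \<notin> W 3" for k
  proof (cases "k = T1")
    case True
    then show ?thesis
      using adj_distinct_color[OF r _ W3] disj by auto
  next
    case False
    then show ?thesis
      using path2_distinct_color[OF r _ _ W3, of "b k"] triangleD[OF b, of T1 k] disj by auto
  qed
  moreover have "c k \<notin> W 3" for k
  proof (cases "k = T1")
    case True
    then show ?thesis
      using path3_not_both_W3[OF r b12 bc _ W3] disj by auto
  next
    case False
    then show ?thesis
      using path4_not_both_W3[OF r b12 bc _ _ W3, of "c k"] triangleD[OF c, of T1 k] disj by auto
  qed
  ultimately show False
    using joined_triangles[OF b c bc disj(1)] by blast
qed

end

section \<open>The contradiction in \<open>H\<close>\<close>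

lemma H_triangle_edges:
  assumes "i \<noteq> j"
  shows "{V i, V j} \<in> H_edges" "{Copy k (U i), Copy k (U j)} \<in> H_edges"
    "{Copy k (Copy2 (Bb i)), Copy k (Copy2 (Bb j))} \<in> H_edges"
    "{Copy k (Copy2 (Bc i)), Copy k (Copy2 (Bc j))} \<in> H_edges"
    "{Copy k (Copy3 (Bb i)), Copy k (Copy3 (Bb j))} \<in> H_edges"
    "{Copy k (Copy3 (Bc i)), Copy k (Copy3 (Bc j))} \<in> H_edges"
  using assms unfolding H_edge_iff G3_edge_iff B_edges_def Un_iff
  by (simp_all add: triangle_edge_iff)

lemma H_joining_edges:
  "{V i, Copy i (U T1)} \<in> H_edges"
  "{Copy k (U T2), Copy k (Copy2 (Bb T1))} \<in> H_edges"
  "{Copy k (U T3), Copy k (Copy3 (Bb T1))} \<in> H_edges"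
  "{Copy k (Copy2 (Bb T2)), Copy k (Copy2 (Bc T1))} \<in> H_edges"
  "{Copy k (Copy3 (Bb T2)), Copy k (Copy3 (Bc T1))} \<in> H_edges"
  unfolding H_edge_iff G3_edge_iff B_edges_def by blast+

lemma not_packing_colorable_H: "\<not> packing_colorable H [1, 2, 2, 4]"
proof
  assume "packing_colorable H [1, 2, 2, 4]"
  then obtain W where "packing_coloring H [1, 2, 2, 4] W"
    by (auto simp: packing_colorable_def)
  then interpret packing_1224 H W
    by unfold_locales (auto simp: H_def)
  have E: "snd H = H_edges"
    by (simp add: H_def)
  note tri = H_triangle_edges[folded E] and join = H_joining_edges[folded E]
  have triangles: "triangle V" "triangle (\<lambda>i. Copy k (U i))"
    "triangle (\<lambda>i. Copy k (Copy2 (Bb i)))" "triangle (\<lambda>i. Copy k (Copy2 (Bc i)))"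
    "triangle (\<lambda>i. Copy k (Copy3 (Bb i)))" "triangle (\<lambda>i. Copy k (Copy3 (Bc i)))" for k
    by (simp_all add: triangle_def inj_def tri)
  have U23: "Copy k (U T2) \<notin> W 3" "Copy k (U T3) \<notin> W 3" for k
    using root_neighbour_not_W3[OF triangles(3,4) join(4,2)]
      root_neighbour_not_W3[OF triangles(5,6) join(5,3)] by auto
  obtain i where Vi: "V i \<in> W 3"
  proof (rule ccontr)
    assume "\<not> thesis"
    then have "V i \<notin> W 3" for i
      using that by blast
    then have "\<exists>j. Copy k (U j) \<in> W 3" for k
      using joined_triangles[OF triangles(1,2) join(1), of k] by auto
    then have "Copy k (U T1) \<in> W 3" for k
      using U23[of k] by (metis three.exhaust)
    \<comment> \<open>The roots of the first two gadgets are joined by three edges through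
      \<open>V T1\<close> and \<open>V T2\<close>.\<close>
    then show False
      using path3_not_both_W3[of "Copy T1 (U T1)" "V T1" "V T2" "Copy T2 (U T1)"] join(1) tri(1)
      by (simp add: insert_commute)
  qed
  \<comment> \<open>\<open>U T1\<close> is adjacent to \<open>V i\<close>; the other two are
    excluded by \<open>U23\<close>.\<close>
  have "Copy i (U k) \<notin> W 3" for k
    using adj_distinct_color[OF join(1) _ Vi] U23[of i] by (cases k) auto
  then obtain k where k: "Copy i (Copy2 (Bb k)) \<in> W 3"
    using joined_triangles[OF triangles(2,3) join(2), of i] by auto
  \<comment> \<open>These three edges lead from \<open>V i\<close> to the root \<open>Bb T1\<close>
    of \<open>Copy2\<close>; one more reaches the rest of its triangle.\<close>
  note path = join(1)[of i] tri(2)[of T1 T2 i] join(2)[of i]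
  show False
  proof (cases "k = T1")
    case True
    then show False
      using path3_not_both_W3[OF path _ Vi] k by simp
  next
    case False
    then show False
      using path4_not_both_W3[OF path _ _ Vi] tri(3)[of T1 k i] k by simp
  qed
qed

theorem claim18:
  shows "subcubic H \<and> outerplanar H \<and> \<not> packing_colorable H [1, 2, 2, 4]"
  using subcubic_H outerplanar_H not_packing_colorable_H by blast

end
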